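(* Let $G=(V,E)$ be a finite simple graph with $n=|V|$, let $\Pi_p=(C_1,\dots,C_n)$ be a partial $k$-coloring of $G$ with set of uncolored vertices $U$, and let $M=\max_{1\le i\le n}|C_i|$. Let $k_0$ be an integer with $k\le k_0\le n$ and assume $M\le\lceil n/k_0\rceil$. Suppose that $U$ is the union of $l$ pairwise disjoint vertex sets $U^1,\dots,U^l$, and for each $j=1,\dots,l$ let $\alpha^j\in\mathbb{N}_0$ be an upper bound on the stability number of the induced subgraph $G[U^j]$. If $\Pi_p$ can be extended to an equitable $k_0$-coloring of $G$, then the network $N(G,\Pi_p,k_0)$ has an admissible $s$-$t$-flow of value $|U|$.
   Context: A set of vertices is stable if its elements are pairwise nonadjacent; the stability number of a graph is the maximum size of a stable set. A $k$-coloring of $G$ is a tuple $(C_1,\dots,C_n)$ of pairwise disjoint stable sets with $C_1\cup\dots\cup C_k=V$ and $C_i=\emptyset$ for $i>k$; it is equitable if $\bigl||C_i|-|C_j|\bigr|\le 1$ for all $i,j\in\{1,\dots,k\}$. A partial $k$-coloring of $G$ is a tuple $\Pi_p=(C_1,\dots,C_n)$ of pairwise disjoint stable subsets of $V$ with $C_i=\emptyset$ for $i>k$ (its classes need not cover $V$). The uncolored vertices are $U=V\setminus(C_1\cup\dots\cup C_k)$. For $v\in U$, the set of free colors is $F(v)=\{1,\dots,n\}\setminus\{i : C_i \text{ contains a neighbor of } v\}$. $\Pi_p$ can be extended to an equitable $k_0$-coloring ($k_0\ge k$) if there is an equitable $k_0$-coloring $(\tilde C_1,\dots,\tilde C_n)$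 with $\tilde C_i\supseteq C_i$ for $i=1,\dots,k_0$. The directed network $N(G,\Pi_p,k_0)=(V_N,A_N)$ depends also on the decomposition $U=U^1\cup\dots\cup U^l$ and the numbers $\alpha^j$. Its vertex set is $V_N=\{s\}\cup U\cup\bigcup_{j=1}^l F^j\cup C\cup\{t\}$, where $C=\{1,\dots,k_0\}$ and, for each $j$, $F^j=\{f^j(1),\dots,f^j(k_0)\}$ is a copy of $C$ (all these sets taken disjoint). Its arc set is $A_N=A_1\cup A_2\cup A_3\cup A_4$ with $A_1=\{(s,v): v\in U\}$, $A_2=\bigcup_{j=1}^l\{(v,f^j(i)): v\in U^j,\ i\in F(v),\ 1\le i\le k_0\}$, $A_3=\bigcup_{j=1}^l\{(f^j(i),i): i=1,\dots,k_0\}$, $A_4=\{(i,t): i=1,\dots,k_0\}$. Each arc $a$ has a lower capacity $c(a)$ and an upper capacity $d(a)$: $c(i,t)=\lfloor n/k_0\rfloor-|C_i|$ and $d(i,t)=\lceil n/k_0\rceil-|C_i|$ for $(i,t)\in A_4$; $c=0$ and $d=\alpha^j$ for $(f^j(i),i)\in A_3$; $c=0$ and $d=1$ for all arcs in $A_1\cup A_2$. An admissible flow is a function $x:A_N\to\mathbb{R}$ with $c(a)\le x_a\le d(a)$ for all arcs and flow conservation at all vertices other than $s,t$; its value is $\sum_{v\in U}x_{(s,v)}$. *)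

theory Defs
  imports Complex_Main "HOL-Library.Disjoint_Sets" "Graph_Theory.Graph_Theory"
begin

text \<open>
  A finite simple graph is a digraph satisfying the locale predicate \<open>graph\<close> (finite, loop-free,
  no parallel arcs, symmetric): each undirected edge is a pair of opposite arcs, and
  \<open>u \<rightarrow>\<^bsub>G\<^esub> v\<close> is adjacency.
\<close>

definition stable_set :: "('a, 'b) pre_digraph \<Rightarrow> 'a set \<Rightarrow> bool" where
  "stable_set G S \<longleftrightarrow> S \<subseteq> verts G \<and> pairwise (\<lambda>u v. \<not> u \<rightarrow>\<^bsub>G\<^esub> v) S"

definition stability_number :: "('a, 'b) pre_digraph \<Rightarrow> nat" where
  "stability_number G = Max {card S | S. stable_set G S}"

text \<open>
  A tuple \<open>(C\<^sub>1, \<dots>, C\<^sub>n)\<close> with \<open>n = card (verts G)\<close> is a function on \<open>nat\<close> of which only the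
  values at the indices \<open>1, \<dots>, n\<close> matter. The predicates below are meant for \<open>k \<le> n\<close>.
\<close>

definition partial_coloring :: "('a, 'b) pre_digraph \<Rightarrow> nat \<Rightarrow> (nat \<Rightarrow> 'a set) \<Rightarrow> bool" where
  "partial_coloring G k C \<longleftrightarrow>
     (\<forall>i\<in>{1..card (verts G)}. stable_set G (C i)) \<and>
     disjoint_family_on C {1..card (verts G)} \<and>
     (\<forall>i\<in>{1..card (verts G)}. k < i \<longrightarrow> C i = {})"

definition coloring :: "('a, 'b) pre_digraph \<Rightarrow> nat \<Rightarrow> (nat \<Rightarrow> 'a set) \<Rightarrow> bool" where
  "coloring G k C \<longleftrightarrow> partial_coloring G k C \<and> (\<Union>i\<in>{1..k}. C i) = verts G"

definition equitable_coloring :: "('a, 'b) pre_digraph \<Rightarrow> nat \<Rightarrow> (nat \<Rightarrow> 'a set) \<Rightarrow> bool" where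
  "equitable_coloring G k C \<longleftrightarrow> coloring G k C \<and>
     (\<forall>i\<in>{1..k}. \<forall>j\<in>{1..k}. \<bar>int (card (C i)) - int (card (C j))\<bar> \<le> 1)"

definition extends_to_equitable :: "('a, 'b) pre_digraph \<Rightarrow> (nat \<Rightarrow> 'a set) \<Rightarrow> nat \<Rightarrow> bool" where
  "extends_to_equitable G C k0 \<longleftrightarrow>
     (\<exists>D. equitable_coloring G k0 D \<and> (\<forall>i\<in>{1..k0}. C i \<subseteq> D i))"

definition uncolored :: "('a, 'b) pre_digraph \<Rightarrow> nat \<Rightarrow> (nat \<Rightarrow> 'a set) \<Rightarrow> 'a set" where
  "uncolored G k C = verts G - (\<Union>i\<in>{1..k}. C i)"

definition free_colors :: "('a, 'b) pre_digraph \<Rightarrow> (nat \<Rightarrow> 'a set) \<Rightarrow> 'a \<Rightarrow> nat set" where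
  "free_colors G C v = {1..card (verts G)} - {i. \<exists>w\<in>C i. v \<rightarrow>\<^bsub>G\<^esub> w}"

text \<open>\<open>Copy j i\<close> is the vertex \<open>f\<^sup>j(i)\<close>, the copy of color \<open>i\<close> belonging to \<open>U\<^sup>j\<close>.\<close>

datatype 'a node = Source | Vertex 'a | Copy nat nat | Color nat | Sink

definition network ::
  "('a, 'b) pre_digraph \<Rightarrow> nat \<Rightarrow> (nat \<Rightarrow> 'a set) \<Rightarrow> nat \<Rightarrow> nat \<Rightarrow> (nat \<Rightarrow> 'a set) \<Rightarrow>
     ('a node, 'a node \<times> 'a node) pre_digraph" where
  "network G k C k0 l U = \<lparr>
     verts = {Source} \<union> Vertex ` uncolored G k C \<union> (\<Union>j\<in>{1..l}. Copy j ` {1..k0})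
       \<union> Color ` {1..k0} \<union> {Sink},
     arcs = {(Source, Vertex v) | v. v \<in> uncolored G k C}
       \<union> (\<Union>j\<in>{1..l}. {(Vertex v, Copy j i) | v i. v \<in> U j \<and> i \<in> free_colors G C v \<and> i \<in> {1..k0}})
       \<union> (\<Union>j\<in>{1..l}. {(Copy j i, Color i) | i. i \<in> {1..k0}})
       \<union> {(Color i, Sink) | i. i \<in> {1..k0}},
     tail = fst, head = snd \<rparr>"

text \<open>
  Capacities are real numbers since lower capacities can be negative: \<open>\<lfloor>n/k0\<rfloor> - |C\<^sub>i| = -1\<close>
  is possible. Values at pairs that are not arcs are irrelevant.
\<close>

fun lower_capacity ::
  "('a, 'b) pre_digraph \<Rightarrow> (nat \<Rightarrow> 'a set) \<Rightarrow> nat \<Rightarrow> 'a node \<times> 'a node \<Rightarrow> real" where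
  "lower_capacity G C k0 (Color i, Sink) =
     real_of_int \<lfloor>real (card (verts G)) / real k0\<rfloor> - real (card (C i))"
| "lower_capacity G C k0 _ = 0"

fun upper_capacity ::
  "('a, 'b) pre_digraph \<Rightarrow> (nat \<Rightarrow> 'a set) \<Rightarrow> nat \<Rightarrow> (nat \<Rightarrow> nat) \<Rightarrow> 'a node \<times> 'a node \<Rightarrow> real" where
  "upper_capacity G C k0 \<alpha> (Color i, Sink) =
     real_of_int \<lceil>real (card (verts G)) / real k0\<rceil> - real (card (C i))"
| "upper_capacity G C k0 \<alpha> (Copy j _, Color _) = real (\<alpha> j)"
| "upper_capacity G C k0 \<alpha> _ = 1"

definition admissible_flow ::
  "('v, 'e) pre_digraph \<Rightarrow> ('e \<Rightarrow> real) \<Rightarrow> ('e \<Rightarrow> real) \<Rightarrow> 'v \<Rightarrow> 'v \<Rightarrow> ('e \<Rightarrow> real) \<Rightarrow> bool" where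
  "admissible_flow N c d s t x \<longleftrightarrow>
     (\<forall>a\<in>arcs N. c a \<le> x a \<and> x a \<le> d a) \<and>
     (\<forall>v\<in>verts N - {s, t}. (\<Sum>a\<in>in_arcs N v. x a) = (\<Sum>a\<in>out_arcs N v. x a))"

definition flow_value ::
  "('a, 'b) pre_digraph \<Rightarrow> nat \<Rightarrow> (nat \<Rightarrow> 'a set) \<Rightarrow> ('a node \<times> 'a node \<Rightarrow> real) \<Rightarrow> real" where
  "flow_value G k C x = (\<Sum>v\<in>uncolored G k C. x (Source, Vertex v))"

end

theory Submission
  imports Defs
begin

text \<open>
  Let \<open>D\<close> be an equitable \<open>k0\<close>-coloring that extends \<open>C\<close>. Every uncolored vertex \<open>v\<close> lies in
  exactly one part \<open>U j\<close> and exactly one class \<open>D i\<close>, so it determines the path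
  \<open>Source, Vertex v, Copy j i, Color i, Sink\<close>. Its arcs are arcs of the network: \<open>i\<close> is free for \<open>v\<close>
  because \<open>C i \<union> {v} \<subseteq> D i\<close> is stable. Sending one unit of flow along each of these paths gives
  a flow of value \<open>|W|\<close>, where \<open>W\<close> is the set of uncolored vertices.

  It remains to check the capacities. The arc from \<open>Copy j i\<close> to \<open>Color i\<close> carries
  \<open>|U j \<inter> D i|\<close> units, the size of a stable set of \<open>G[U j]\<close>, hence at most \<open>\<alpha> j\<close>
  (\<open>card_le_stability_number\<close>). The arc from \<open>Color i\<close> to \<open>Sink\<close> carries \<open>|W \<inter> D i|\<close> units.
  Since the classes of \<open>D\<close> are disjoint, the colored vertices in \<open>D i\<close> are exactly those of \<open>C i\<close>,
  so this number is \<open>|D i| - |C i|\<close> (\<open>card_uncolored_Int_class\<close>); and the sizes of the classes of an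
  equitable coloring lie between \<open>\<lfloor>n/k0\<rfloor>\<close> and \<open>\<lceil>n/k0\<rceil>\<close> (\<open>balanced_bounds\<close>).
\<close>

section \<open>Balanced families of numbers\<close>

text \<open>
  Numbers that pairwise differ by at most one are squeezed between the rounded values of their
  average: all of them are at most \<open>f i + 1\<close>, and \<open>f i\<close> itself is smaller than that, so the average is
  strictly below \<open>f i + 1\<close>. In the same way it is strictly above \<open>f i - 1\<close>.
\<close>

lemma balanced_bounds:
  fixes f :: "'i \<Rightarrow> nat"
  assumes fin: "finite I" and i: "i \<in> I"
    and bal: "\<And>i j. i \<in> I \<Longrightarrow> j \<in> I \<Longrightarrow> \<bar>int (f i) - int (f j)\<bar> \<le> 1"
  shows "\<lfloor>real (\<Sum>j\<in>I. f j) / real (card I)\<rfloor> \<le> int (f i)"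
    and "int (f i) \<le> \<lceil>real (\<Sum>j\<in>I. f j) / real (card I)\<rceil>"
proof -
  have pos: "0 < real (card I)"
    using fin i by (auto simp: card_gt_0_iff)
  have up: "real (f j) \<le> real (f i) + 1" and low: "real (f i) - 1 \<le> real (f j)" if "j \<in> I" for j
    using bal[OF i that] by linarith+
  have "(\<Sum>j\<in>I. real (f j)) < (\<Sum>j\<in>I. real (f i) + 1)"
    by (rule sum_strict_mono_ex1) (use fin i up in \<open>auto intro: bexI[of _ i]\<close>)
  then have "real (\<Sum>j\<in>I. f j) / real (card I) < real (f i) + 1"
    using pos by (simp add: field_simps)
  then show "\<lfloor>real (\<Sum>j\<in>I. f j) / real (card I)\<rfloor> \<le> int (f i)"
    by linarith
  have "(\<Sum>j\<in>I. real (f i) - 1) < (\<Sum>j\<in>I. real (f j))"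
    by (rule sum_strict_mono_ex1) (use fin i low in \<open>auto intro: bexI[of _ i]\<close>)
  then have "real (f i) - 1 < real (\<Sum>j\<in>I. f j) / real (card I)"
    using pos by (simp add: field_simps)
  then show "int (f i) \<le> \<lceil>real (\<Sum>j\<in>I. f j) / real (card I)\<rceil>"
    by linarith
qed

section \<open>Stable sets\<close>

lemma card_le_stability_number:
  assumes "finite (verts H)" and "stable_set H S"
  shows "card S \<le> stability_number H"
proof -
  have "{card S | S. stable_set H S} \<subseteq> card ` Pow (verts H)"
    by (auto simp: stable_set_def)
  then have "finite {card S | S. stable_set H S}"
    using assms(1) by (meson finite_Pow_iff finite_imageI finite_subset)
  then show ?thesis
    unfolding stability_number_def using assms(2) by (intro Max_ge) auto
qed

lemma stable_set_induce_subgraph: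
  assumes "stable_set G S"
  shows "stable_set (G \<restriction> W) (W \<inter> S)"
  using assms unfolding stable_set_def pairwise_def
  by (auto simp: arcs_ends_def arc_to_ends_def)

section \<open>Classes of an equitable coloring\<close>

context
  fixes G :: "('a, 'b) pre_digraph" and k0 :: nat and D :: "nat \<Rightarrow> 'a set"
  assumes fin: "finite (verts G)" and k0_le: "k0 \<le> card (verts G)"
    and equitable: "equitable_coloring G k0 D"
begin

lemma class_stable: "i \<in> {1..k0} \<Longrightarrow> stable_set G (D i)"
  using equitable k0_le by (auto simp: equitable_coloring_def coloring_def partial_coloring_def)

lemma class_finite: "i \<in> {1..k0} \<Longrightarrow> finite (D i)"
  using class_stable fin by (meson finite_subset stable_set_def)

lemma classes_disjoint: "disjoint_family_on D {1..k0}"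
  using equitable k0_le
  by (auto simp: equitable_coloring_def coloring_def partial_coloring_def disjoint_family_on_def)

lemma classes_cover: "(\<Union>i\<in>{1..k0}. D i) = verts G"
  using equitable by (simp add: equitable_coloring_def coloring_def)

lemma class_card_bounds:
  assumes "i \<in> {1..k0}"
  shows "\<lfloor>real (card (verts G)) / real k0\<rfloor> \<le> int (card (D i))"
    and "int (card (D i)) \<le> \<lceil>real (card (verts G)) / real k0\<rceil>"
proof -
  have n: "card (verts G) = (\<Sum>i\<in>{1..k0}. card (D i))"
    unfolding classes_cover[symmetric]
    by (rule card_UN_disjoint) (use class_finite classes_disjoint in
        \<open>auto simp: disjoint_family_on_def\<close>)
  have "\<bar>int (card (D i)) - int (card (D j))\<bar> \<le> 1" if "i \<in> {1..k0}" "j \<in> {1..k0}" for i j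
    using equitable that by (simp add: equitable_coloring_def)
  from balanced_bounds[OF _ assms, of "\<lambda>i. card (D i)", OF _ this]
  show "\<lfloor>real (card (verts G)) / real k0\<rfloor> \<le> int (card (D i))"
    and "int (card (D i)) \<le> \<lceil>real (card (verts G)) / real k0\<rceil>"
    by (simp_all add: n)
qed

lemma class_unique:
  assumes "v \<in> D i" "v \<in> D i'" "i \<in> {1..k0}" "i' \<in> {1..k0}"
  shows "i = i'"
  using disjoint_family_onD[OF classes_disjoint assms(3,4)] assms(1,2) by blast

lemma class_color_free:
  assumes "v \<in> D i" "i \<in> {1..k0}" "C i \<subseteq> D i" "v \<notin> C i"
  shows "i \<in> free_colors G C v"
proof -
  have "\<not> v \<rightarrow>\<^bsub>G\<^esub> w" if "w \<in> C i" for w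
  proof -
    have "w \<in> D i" and "v \<noteq> w"
      using assms that by auto
    then show ?thesis
      using class_stable[OF assms(2)] assms(1) unfolding stable_set_def pairwise_def by blast
  qed
  then show ?thesis
    using assms(2) k0_le by (auto simp: free_colors_def)
qed

text \<open>
  A vertex of \<open>D i\<close> that is colored by \<open>C\<close> must have color \<open>i\<close> there, since its class in \<open>C\<close> is
  contained in the class of \<open>D\<close> with the same index.
\<close>

lemma card_uncolored_Int_class:
  assumes "partial_coloring G k C" "k \<le> k0" "\<forall>i\<in>{1..k0}. C i \<subseteq> D i" and i: "i \<in> {1..k0}"
  shows "real (card (uncolored G k C \<inter> D i)) = real (card (D i)) - real (card (C i))"
proof -
  \<comment> \<open>\<open>uncolored\<close> only removes the first \<open>k\<close> classes, while \<open>i\<close> may exceed \<open>k\<close>.\<close>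
  have empty: "C i = {}" if "\<not> i \<le> k"
    using assms(1) i k0_le that by (auto simp: partial_coloring_def)
  have "uncolored G k C \<inter> D i = D i - C i"
  proof (intro equalityI subsetI)
    fix v assume "v \<in> uncolored G k C \<inter> D i"
    then show "v \<in> D i - C i"
      using empty i by (auto simp: uncolored_def)
  next
    fix v assume v: "v \<in> D i - C i"
    have "v \<notin> C i'" if "i' \<in> {1..k}" for i'
    proof
      assume "v \<in> C i'"
      moreover have "i' \<in> {1..k0}"
        using that assms(2) by auto
      ultimately have "i = i'"
        using assms(3) v i by (intro class_unique[of v]) auto
      with \<open>v \<in> C i'\<close> v show False by simp
    qed
    then show "v \<in> uncolored G k C \<inter> D i"
      using v i classes_cover by (auto simp: uncolored_def)
  qed
  moreover have "C i \<subseteq> D i" and "finite (D i)"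
    using assms(3) i class_finite by auto
  ultimately show ?thesis
    by (simp add: card_Diff_subset card_mono finite_subset of_nat_diff)
qed

end

section \<open>The flow along the paths\<close>

text \<open>
  The superposition of the unit flows along the paths of all vertices in \<open>W\<close>. The last equation
  serves the arcs from \<open>Source\<close>, each of which lies on exactly one path.
\<close>

fun path_flow ::
  "(nat \<Rightarrow> 'a set) \<Rightarrow> 'a set \<Rightarrow> (nat \<Rightarrow> 'a set) \<Rightarrow> 'a node \<times> 'a node \<Rightarrow> real" where
  "path_flow U W D (Vertex v, Copy _ i) = of_bool (v \<in> D i)"
| "path_flow U W D (Copy j _, Color i) = real (card (U j \<inter> D i))"
| "path_flow U W D (Color i, Sink) = real (card (W \<inter> D i))"
| "path_flow U W D _ = 1"

lemma in_arcs_network: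
  "in_arcs (network G k C k0 l U) (Vertex v) =
     (if v \<in> uncolored G k C then {(Source, Vertex v)} else {})"
  "in_arcs (network G k C k0 l U) (Copy j i) =
     (if j \<in> {1..l} \<and> i \<in> {1..k0}
      then (\<lambda>v. (Vertex v, Copy j i)) ` {v \<in> U j. i \<in> free_colors G C v} else {})"
  "in_arcs (network G k C k0 l U) (Color i) =
     (if i \<in> {1..k0} then (\<lambda>j. (Copy j i, Color i)) ` {1..l} else {})"
  by (auto simp: in_arcs_def network_def)

lemma out_arcs_network:
  "out_arcs (network G k C k0 l U) (Vertex v) =
     (\<lambda>(j, i). (Vertex v, Copy j i)) `
       ({j \<in> {1..l}. v \<in> U j} \<times> (free_colors G C v \<inter> {1..k0}))"
  "out_arcs (network G k C k0 l U) (Copy j i) =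
     (if j \<in> {1..l} \<and> i \<in> {1..k0} then {(Copy j i, Color i)} else {})"
  "out_arcs (network G k C k0 l U) (Color i) = (if i \<in> {1..k0} then {(Color i, Sink)} else {})"
  by (force simp: out_arcs_def network_def)+

theorem theorem2:
  fixes G :: "('a, 'b) pre_digraph"
    and C U :: "nat \<Rightarrow> 'a set"
    and \<alpha> :: "nat \<Rightarrow> nat"
    and k k0 l :: nat
  assumes "graph G"
    and "partial_coloring G k C"
    and "k \<le> k0" and "k0 \<le> card (verts G)"
    and "int (Max ((\<lambda>i. card (C i)) ` {1..card (verts G)})) \<le> \<lceil>real (card (verts G)) / real k0\<rceil>"
    and "uncolored G k C = (\<Union>j\<in>{1..l}. U j)"
    and "disjoint_family_on U {1..l}"
    and "\<forall>j\<in>{1..l}. stability_number (G \<restriction> U j) \<le> \<alpha> j"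
    and "extends_to_equitable G C k0"
  shows "\<exists>x. admissible_flow (network G k C k0 l U)
               (lower_capacity G C k0) (upper_capacity G C k0 \<alpha>) Source Sink x \<and>
             flow_value G k C x = real (card (uncolored G k C))"
proof -
  let ?N = "network G k C k0 l U"
  let ?W = "uncolored G k C"
  interpret graph G by fact
  have fin: "finite (verts G)" by simp
  obtain D where D: "equitable_coloring G k0 D" and ext: "\<forall>i\<in>{1..k0}. C i \<subseteq> D i"
    using assms(9) by (auto simp: extends_to_equitable_def)
  note coloring_facts = fin \<open>k0 \<le> card (verts G)\<close> D
  note class_card = card_uncolored_Int_class[OF coloring_facts assms(2,3) ext]
  define x where "x = path_flow U ?W D"
  have finW: "finite ?W"
    by (simp add: uncolored_def)
  have UW: "U j \<subseteq> ?W" if "j \<in> {1..l}" for j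
    using that assms(6) by auto
  have finU: "finite (U j)" if "j \<in> {1..l}" for j
    using UW[OF that] finW by (rule finite_subset)
  have free: "i \<in> free_colors G C v" if "v \<in> ?W" "v \<in> D i" "i \<in> {1..k0}" for v i
  proof (rule class_color_free[OF coloring_facts that(2,3)])
    show "C i \<subseteq> D i"
      using ext that(3) by auto
    have "C i = {}" if "\<not> i \<le> k"
      using assms(2,4) \<open>i \<in> {1..k0}\<close> that by (auto simp: partial_coloring_def)
    then show "v \<notin> C i"
      using that by (auto simp: uncolored_def)
  qed
  have capacity: "lower_capacity G C k0 a \<le> x a \<and> x a \<le> upper_capacity G C k0 \<alpha> a"
    if "a \<in> arcs ?N" for a
  proof -
    from that consider
        (source) v where "a = (Source, Vertex v)"
      | (choice) v j i where "a = (Vertex v, Copy j i)"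
      | (part) j i where "a = (Copy j i, Color i)" "j \<in> {1..l}" "i \<in> {1..k0}"
      | (sink) i where "a = (Color i, Sink)" "i \<in> {1..k0}"
      by (auto simp: network_def)
    then show ?thesis
    proof cases
      case source
      then show ?thesis by (simp add: x_def)
    next
      case choice
      then show ?thesis by (simp add: x_def)
    next
      case part
      have "stable_set (G \<restriction> U j) (U j \<inter> D i)"
        using class_stable[OF coloring_facts part(3)] by (rule stable_set_induce_subgraph)
      then have "card (U j \<inter> D i) \<le> stability_number (G \<restriction> U j)"
        using finU[OF part(2)] by (intro card_le_stability_number) auto
      also have "\<dots> \<le> \<alpha> j"
        using assms(8) part(2) by blast
      finally show ?thesis
        using part(1) by (simp add: x_def)
    next
      case sink
      have "real_of_int \<lfloor>real (card (verts G)) / real k0\<rfloor> \<le> real (card (D i))"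
        and "real (card (D i)) \<le> real_of_int \<lceil>real (card (verts G)) / real k0\<rceil>"
        using class_card_bounds[OF coloring_facts sink(2)] by linarith+
      then show ?thesis
        using class_card[OF sink(2)] sink(1) by (simp add: x_def)
    qed
  qed
  have conservation: "(\<Sum>a\<in>in_arcs ?N w. x a) = (\<Sum>a\<in>out_arcs ?N w. x a)"
    if "w \<in> verts ?N - {Source, Sink}" for w
  proof -
    from that consider
        (vertex) v where "w = Vertex v" "v \<in> ?W"
      | (copy) j i where "w = Copy j i" "j \<in> {1..l}" "i \<in> {1..k0}"
      | (color) i where "w = Color i" "i \<in> {1..k0}"
      by (auto simp: network_def)
    then show ?thesis
    proof cases
      case vertex
      obtain j where j: "j \<in> {1..l}" "v \<in> U j"
        using vertex(2) assms(6) by auto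
      have parts: "{j \<in> {1..l}. v \<in> U j} = {j}"
        using j disjoint_family_onD[OF assms(7) _ j(1)] by blast
      have "v \<in> (\<Union>i\<in>{1..k0}. D i)"
        using vertex(2) unfolding classes_cover[OF coloring_facts] by (simp add: uncolored_def)
      then obtain i where i: "i \<in> {1..k0}" "v \<in> D i"
        by blast
      have "out_arcs ?N w = (\<lambda>i. (Vertex v, Copy j i)) ` (free_colors G C v \<inter> {1..k0})"
        unfolding vertex(1) out_arcs_network parts by auto
      then have "(\<Sum>a\<in>out_arcs ?N w. x a) =
          (\<Sum>i\<in>free_colors G C v \<inter> {1..k0}. of_bool (v \<in> D i))"
        by (simp add: sum.reindex inj_on_def x_def)
      also have "\<dots> = (\<Sum>i\<in>{i}. of_bool (v \<in> D i))"
        by (rule sum.mono_neutral_right)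
          (use free[OF vertex(2) i(2,1)] i class_unique[OF coloring_facts] in auto)
      finally show ?thesis
        using i vertex by (simp add: in_arcs_network x_def)
    next
      case copy
      have "(\<Sum>a\<in>in_arcs ?N w. x a) = (\<Sum>v\<in>{v \<in> U j. i \<in> free_colors G C v}. of_bool (v \<in> D i))"
        unfolding copy(1) in_arcs_network using copy(2,3)
        by (simp add: sum.reindex inj_on_def x_def)
      also have "\<dots> = (\<Sum>v\<in>U j \<inter> D i. 1)"
        by (rule sum.mono_neutral_cong_right)
          (use finU[OF copy(2)] free UW[OF copy(2)] copy(3) in auto)
      finally show ?thesis
        using copy by (simp add: out_arcs_network x_def)
    next
      case color
      have "?W \<inter> D i = (\<Union>j\<in>{1..l}. U j \<inter> D i)"
        using assms(6) by auto
      also have "card \<dots> = (\<Sum>j\<in>{1..l}. card (U j \<inter> D i))"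
        by (rule card_UN_disjoint) (use finU assms(7) in \<open>auto simp: disjoint_family_on_def\<close>)
      finally have "real (card (?W \<inter> D i)) = (\<Sum>j\<in>{1..l}. real (card (U j \<inter> D i)))"
        by simp
      then show ?thesis
        using color by (simp add: in_arcs_network out_arcs_network sum.reindex inj_on_def x_def)
    qed
  qed
  have "flow_value G k C x = real (card ?W)"
    by (simp add: flow_value_def x_def)
  with capacity conservation show ?thesis
    unfolding admissible_flow_def by blast
qed

end
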